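(* Let $p$ be an odd prime, let $e \ge 1$ be an integer, let $g$ be an integer that is a generator modulo $p$, and let $c$ be an integer with $c \not\equiv 0 \pmod p$. Let $f(x) = x g^x - c$. Then the number of $x \in \{1, \dots, p^e(p-1) \mid x \not\equiv 0 \pmod p\}$ such that $f(x) \equiv 0 \pmod{p^e}$ is $p-1$, and the set of these solutions forms a complete residue system modulo $p-1$.
   Context: An integer $g$ is a generator modulo $p$ if its class generates the multiplicative group $(\mathbb{Z}/p\mathbb{Z})^\times$. The notation $\{1,\dots,N \mid x\not\equiv 0 \pmod p\}$ denotes the set of integers $x$ with $1 \le x \le N$ and $p \nmid x$. *)

theory Defs
  imports "HOL-Number_Theory.Number_Theory" "HOL-Algebra.Generated_Groups"
begin

definition generator_mod :: "int \<Rightarrow> int \<Rightarrow> bool"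
  where "generator_mod p g \<longleftrightarrow>
    g mod p \<in> carrier (units_of (residue_ring p)) \<and>
    generate (units_of (residue_ring p)) {g mod p} = carrier (units_of (residue_ring p))"

definition complete_residue_system :: "int \<Rightarrow> int set \<Rightarrow> bool"
  where "complete_residue_system m S \<longleftrightarrow> (\<forall>a. \<exists>!x. x \<in> S \<and> [x = a] (mod m))"

definition nonmultiples_upto :: "int \<Rightarrow> int \<Rightarrow> int set"
  where "nonmultiples_upto p N = {x \<in> {1..N}. \<not> [x = 0] (mod p)}"

(* Only used for x > 0, where nat x loses nothing. *)
definition disc_log_fun :: "int \<Rightarrow> int \<Rightarrow> int \<Rightarrow> int"
  where "disc_log_fun g c x = x * g ^ nat x - c"

end

theory Submission
  imports Defs
begin

text \<open>
  Fix a residue class \<open>a\<close> modulo \<open>p - 1\<close>. If \<open>x\<close> and \<open>y\<close> both lie in that class and agree modulo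
  \<open>p ^ k\<close>, then they agree modulo \<open>p ^ k * (p - 1) = totient (p ^ Suc k)\<close>, so \<open>g ^ x\<close> and \<open>g ^ y\<close>
  agree modulo \<open>p ^ Suc k\<close>: the exponential gains one power of \<open>p\<close>. Hence a solution of
  \<open>x * g ^ x = c\<close> modulo \<open>p ^ k\<close> lifts uniquely to one modulo \<open>p ^ Suc k\<close>, by solving the linear
  congruence \<open>y * g ^ x = c\<close> for \<open>y\<close>. So every class modulo \<open>p - 1\<close> contains exactly one solution.
\<close>

text \<open>Supplies the invertibility of powers of \<open>g\<close> modulo \<open>p ^ k\<close>,
  for cancellation and for Euler's theorem.\<close>

lemma generator_mod_coprime:
  assumes "prime p" "generator_mod p g"
  shows "coprime g p"
proof -
  have "p > 1" using assms(1) by (rule prime_gt_1_int)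
  then have "residues p" by (simp add: residues_def)
  moreover have "g mod p \<in> Units (residue_ring p)"
    using assms(2) by (simp add: generator_mod_def units_of_def)
  ultimately have "coprime (g mod p) p"
    using residues.res_units_eq by blast
  then show ?thesis using \<open>p > 1\<close> by simp
qed

lemma card_complete_residue_system:
  assumes "complete_residue_system m S" "m > 0"
  shows "int (card S) = m"
proof -
  have "bij_betw (\<lambda>x. x mod m) S {0..<m}"
    unfolding bij_betw_def
  proof
    show "inj_on (\<lambda>x. x mod m) S"
      using assms(1) unfolding complete_residue_system_def cong_def inj_on_def by blast
    show "(\<lambda>x. x mod m) ` S = {0..<m}"
    proof (intro equalityI subsetI)
      fix a assume a: "a \<in> {0..<m}"
      obtain x where "x \<in> S" "[x = a] (mod m)"
        using assms(1) unfolding complete_residue_system_def by blast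
      with a show "a \<in> (\<lambda>x. x mod m) ` S" by (force simp: cong_def)
    qed (use assms(2) in auto)
  qed
  from bij_betw_same_card[OF this] show ?thesis using assms(2) by simp
qed

lemma cong_power_exponent:
  fixes g m :: int and a b t :: nat
  assumes "[g ^ t = 1] (mod m)" "[a = b] (mod t)"
  shows "[g ^ a = g ^ b] (mod m)"
  using assms(2)
\<comment> \<open>With \<open>a \<le> b\<close> the exponents differ by a natural multiple of
  \<open>t\<close>, so no inverse of \<open>g\<close> has to be formed.\<close>
proof (induction a b rule: linorder_wlog)
  case (le a b)
  then obtain q where "b = a + t * q"
    by (metis cong_altdef_nat cong_sym dvdE le_add_diff_inverse)
  moreover have "[g ^ a * (g ^ t) ^ q = g ^ a * 1 ^ q] (mod m)"
    by (intro cong_mult cong_refl cong_pow assms(1))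
  ultimately show ?case by (simp add: power_add power_mult cong_sym)
qed (blast intro: cong_sym)

text \<open>Since \<open>p\<close> is 1 modulo \<open>p - 1\<close>, so is \<open>p ^ k\<close>.
  Hence conditions modulo \<open>p ^ k\<close> and modulo \<open>p - 1\<close> can be prescribed
  independently and combined.\<close>

lemma coprime_prime_power_diff_one:
  fixes p :: int
  shows "coprime (p ^ k) (p - 1)"
  by simp

lemma power_cong_lift:
  fixes p g x y :: int
  assumes "prime p" "coprime g p" "x \<ge> 0" "y \<ge> 0"
    and "[x = y] (mod p ^ k)" "[x = y] (mod (p - 1))"
  shows "[g ^ nat x = g ^ nat y] (mod p ^ Suc k)"
proof (rule cong_power_exponent)
  have p: "p > 1" using assms(1) by (rule prime_gt_1_int)
  then have "p ^ Suc k > 1" by (rule one_less_power) simp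
  then have "residues (p ^ Suc k)" by (simp add: residues_def)
  moreover have "coprime g (p ^ Suc k)" using assms(2) by simp
  ultimately show "[g ^ totient (nat (p ^ Suc k)) = 1] (mod p ^ Suc k)"
    by (rule residues.euler_theorem)
  have "prime (nat p)" using assms(1) by simp
  then have "totient (nat (p ^ Suc k)) = nat p ^ k * (nat p - 1)"
    using totient_prime_power_Suc[of "nat p" k] p by (simp only: nat_power_eq)
  then have "int (totient (nat (p ^ Suc k))) = p ^ k * (p - 1)"
    using p by (simp add: of_nat_diff)
  moreover have "[x = y] (mod p ^ k * (p - 1))"
    using assms(5,6) coprime_prime_power_diff_one by (rule coprime_cong_mult)
  ultimately have "[int (nat x) = int (nat y)] (mod int (totient (nat (p ^ Suc k))))"
    using assms(3,4) by simp
  then show "[nat x = nat y] (mod totient (nat (p ^ Suc k)))"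
    by (simp only: cong_int_iff)
qed

lemma exp_solution_unique:
  fixes p g c x y :: int
  assumes p: "prime p" and g: "coprime g p" and "x \<ge> 0" "y \<ge> 0"
    and xy: "[x = y] (mod (p - 1))"
    and x: "[x * g ^ nat x = c] (mod p ^ e)" and y: "[y * g ^ nat y = c] (mod p ^ e)"
  shows "[x = y] (mod p ^ e)"
  using x y
proof (induction e)
  case (Suc e)
  \<comment> \<open>Both equations weaken to the modulus \<open>p ^ e\<close>; the congruence found
    there makes the exponentials agree one power higher, where the unit \<open>g ^ nat x\<close>
    cancels.\<close>
  have "[x = y] (mod p ^ e)"
    using Suc.prems by (intro Suc.IH) (auto intro: cong_modulus_mult[of _ _ "p ^ e" p] simp: mult.commute)
  then have "[g ^ nat x = g ^ nat y] (mod p ^ Suc e)"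
    using assms by (intro power_cong_lift) auto
  then have "[y * g ^ nat x = y * g ^ nat y] (mod p ^ Suc e)"
    by (rule cong_scalar_left)
  with Suc.prems have "[x * g ^ nat x = y * g ^ nat x] (mod p ^ Suc e)"
    by (meson cong_sym cong_trans)
  moreover have "coprime (g ^ nat x) (p ^ Suc e)" using g by simp
  ultimately show ?case by (simp only: cong_mult_rcancel)
qed simp

lemma ex_cong_positive_le:
  fixes m a :: int
  assumes "m > 0"
  shows "\<exists>x\<in>{1..m}. [x = a] (mod m)"
proof
  \<comment> \<open>Shifting by one before and after reduction moves the representatives from
    \<open>{0..<m}\<close> to \<open>{1..m}\<close>.\<close>
  show "(a - 1) mod m + 1 \<in> {1..m}"
    using assms pos_mod_bound[of m "a - 1"] by (simp add: add1_zle_eq)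
  show "[(a - 1) mod m + 1 = a] (mod m)"
    by (simp add: cong_def mod_add_left_eq)
qed

lemma exp_solution_exists:
  fixes p g c a :: int
  assumes p: "prime p" and g: "coprime g p"
  shows "\<exists>x\<in>{1..p ^ e * (p - 1)}. [x = a] (mod (p - 1)) \<and> [x * g ^ nat x = c] (mod p ^ e)"
proof (induction e)
  case 0
  have "p - 1 > 0" using prime_gt_1_int[OF p] by simp
  from ex_cong_positive_le[OF this, of a] show ?case by simp
next
  case (Suc e)
  let ?q = "p ^ Suc e"
  have p1: "p > 1" using p by (rule prime_gt_1_int)
  obtain x where x: "x \<ge> 1" "[x = a] (mod (p - 1))" "[x * g ^ nat x = c] (mod p ^ e)"
    using Suc.IH by auto
  have cop: "coprime (g ^ nat x) (p ^ k)" for k using g by simp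
  obtain h where h: "[g ^ nat x * h = 1] (mod ?q)"
    using cong_solve_coprime_int[OF cop] by blast
  \<comment> \<open>The exponent stays frozen at the old solution \<open>x\<close>, so
    \<open>c * h\<close> solves a linear congruence; the Chinese remainder theorem keeps the class
    of \<open>a\<close>.\<close>
  obtain z where z: "[z = c * h] (mod ?q)" "[z = a] (mod (p - 1))"
    using binary_chinese_remainder_int[OF coprime_prime_power_diff_one] by blast
  have "?q * (p - 1) > 0" using p1 by simp
  from ex_cong_positive_le[OF this] obtain y
    where y: "y \<in> {1..?q * (p - 1)}" "[y = z] (mod ?q * (p - 1))" by blast
  have ya: "[y = a] (mod (p - 1))"
    using y(2) z(2) by (metis cong_modulus_mult cong_trans mult.commute)
  have "[y = c * h] (mod ?q)"
    using y(2) z(1) by (metis cong_modulus_mult cong_trans)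
  then have "[y * g ^ nat x = c * h * g ^ nat x] (mod ?q)" by (rule cong_scalar_right)
  also have "c * h * g ^ nat x = c * (g ^ nat x * h)" by simp
  also have "[\<dots> = c * 1] (mod ?q)" using h by (rule cong_scalar_left)
  finally have yx: "[y * g ^ nat x = c] (mod ?q)" by simp
  then have "[y * g ^ nat x = c] (mod p ^ e)"
    by (metis cong_modulus_mult mult.commute power_Suc)
  with x(3) have "[y * g ^ nat x = x * g ^ nat x] (mod p ^ e)"
    by (meson cong_sym cong_trans)
  then have "[y = x] (mod p ^ e)" using cop by (simp only: cong_mult_rcancel)
  moreover have "[y = x] (mod (p - 1))" using ya x(2) by (meson cong_sym cong_trans)
  ultimately have "[g ^ nat y = g ^ nat x] (mod ?q)"
    using p g x(1) y(1) by (intro power_cong_lift) auto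
  then have "[y * g ^ nat y = c] (mod ?q)"
    using yx by (meson cong_scalar_left cong_trans)
  with y(1) ya show ?case by blast
qed

theorem corollary10:
  fixes p g c :: int and e :: nat
  assumes "prime p" and "odd p"
    and "e \<ge> 1"
    and "generator_mod p g"
    and "\<not> [c = 0] (mod p)"
  shows "int (card {x \<in> nonmultiples_upto p (p ^ e * (p - 1)). [disc_log_fun g c x = 0] (mod p ^ e)}) = p - 1 \<and>
    complete_residue_system (p - 1)
      {x \<in> nonmultiples_upto p (p ^ e * (p - 1)). [disc_log_fun g c x = 0] (mod p ^ e)}"
proof -
  let ?N = "p ^ e * (p - 1)"
  let ?S = "{x \<in> nonmultiples_upto p ?N. [disc_log_fun g c x = 0] (mod p ^ e)}"
  have g: "coprime g p" using assms(1,4) by (rule generator_mod_coprime)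
  \<comment> \<open>A solution is never a multiple of \<open>p\<close>: as \<open>e \<ge> 1\<close>,
    the equation also holds modulo \<open>p\<close>, and \<open>p\<close> would divide
    \<open>c\<close>.\<close>
  have mem: "x \<in> ?S \<longleftrightarrow> x \<in> {1..?N} \<and> [x * g ^ nat x = c] (mod p ^ e)" for x
  proof -
    have "\<not> [x = 0] (mod p)" if x: "[x * g ^ nat x = c] (mod p ^ e)"
    proof
      assume "[x = 0] (mod p)"
      then have "[x * g ^ nat x = 0] (mod p)" by (simp add: cong_0_iff)
      moreover have "[x * g ^ nat x = c] (mod p)"
        using x assms(3) by (auto intro: cong_dvd_modulus dvd_power)
      ultimately show False using assms(5) by (meson cong_sym cong_trans)
    qed
    then show ?thesis
      by (auto simp: nonmultiples_upto_def disc_log_fun_def cong_diff_iff_cong_0)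
  qed
  have "complete_residue_system (p - 1) ?S"
    unfolding complete_residue_system_def
  proof (intro allI ex_ex1I)
    show "\<exists>x. x \<in> ?S \<and> [x = a] (mod (p - 1))" for a
      using exp_solution_exists[OF assms(1) g] unfolding mem by blast
    fix a x y
    assume "x \<in> ?S \<and> [x = a] (mod (p - 1))" and "y \<in> ?S \<and> [y = a] (mod (p - 1))"
    then have x: "x \<in> {1..?N}" "[x * g ^ nat x = c] (mod p ^ e)"
      and y: "y \<in> {1..?N}" "[y * g ^ nat y = c] (mod p ^ e)"
      and xy: "[x = y] (mod (p - 1))"
      unfolding mem by (auto intro: cong_trans cong_sym)
    have "[x = y] (mod p ^ e)"
      using exp_solution_unique[OF assms(1) g _ _ xy x(2) y(2)] x(1) y(1) by simp
    then have "[x = y] (mod ?N)"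
      using xy coprime_prime_power_diff_one by (rule coprime_cong_mult)
    then have "?N dvd x - y" by (simp add: cong_iff_dvd_diff)
    \<comment> \<open>The interval is exactly one period \<open>?N\<close> long, so congruent
      members coincide.\<close>
    moreover have "\<bar>x - y\<bar> < ?N" using x(1) y(1) by auto
    ultimately show "x = y" by (metis dvd_imp_le_int eq_iff_diff_eq_0 abs_ge_self leD order.trans)
  qed
  then show ?thesis
    using card_complete_residue_system prime_gt_1_int[OF assms(1)] by simp
qed

end
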